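(* Let $X$ be a set of $n$ points in the plane in general position whose relative ordering corresponds to a uniformly random permutation of $[n]$. Then $\mathbb{E}[\mathsf{OPT^M}(X)]=\Theta(n\log n)$.
   Context: General position: no two points share an $x$-coordinate or a $y$-coordinate; the relative ordering of such $X$ is the permutation obtained by listing the ranks of the $x$-coordinates of the points in order of increasing $y$-coordinate. A manhattan path between points $x,y$ with respect to a point set $B$ is a sequence of distinct points $(x=x_1,\dots,x_k=y)$ of $B$ such that consecutive points lie on a common horizontal or vertical line and both the $x$-coordinates and the $y$-coordinates form monotone sequences. $\mathsf{OPT^M}(X)$ (the Small Manhattan Network optimum) is the minimum size of a point set $Y\supseteq X$ such that every two points $a,b\in X$ are joined by a manhattan path with respect to $Y$. *)

theory Defs
  imports "HOL-Probability.Probability" "HOL-Combinatorics.Combinatorics"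
begin

type_synonym point = "real \<times> real"

definition general_position :: "point set \<Rightarrow> bool" where
  "general_position X \<longleftrightarrow> inj_on fst X \<and> inj_on snd X"

text \<open>One-line notation: the \<open>i\<close>-th entry is the rank (counted from 1) of the
  \<open>x\<close>-coordinate of the point with the \<open>i\<close>-th smallest \<open>y\<close>-coordinate.  This is meaningful
  for finite sets in general position, where sorting by \<open>snd\<close> is unambiguous.\<close>

definition relative_ordering :: "point set \<Rightarrow> nat list" where
  "relative_ordering X =
     map (\<lambda>p. card {q \<in> X. fst q \<le> fst p}) (sorted_key_list_of_set snd X)"

definition axis_aligned :: "point \<Rightarrow> point \<Rightarrow> bool" where
  "axis_aligned p q \<longleftrightarrow> fst p = fst q \<or> snd p = snd q"

definition monotone_list :: "real list \<Rightarrow> bool" where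
  "monotone_list xs \<longleftrightarrow> sorted_wrt (\<le>) xs \<or> sorted_wrt (\<ge>) xs"

definition manhattan_path :: "point set \<Rightarrow> point \<Rightarrow> point \<Rightarrow> point list \<Rightarrow> bool" where
  "manhattan_path B a b ps \<longleftrightarrow>
     ps \<noteq> [] \<and> hd ps = a \<and> last ps = b \<and> distinct ps \<and> set ps \<subseteq> B \<and>
     successively axis_aligned ps \<and>
     monotone_list (map fst ps) \<and> monotone_list (map snd ps)"

definition manhattan_network :: "point set \<Rightarrow> point set \<Rightarrow> bool" where
  "manhattan_network X Y \<longleftrightarrow>
     X \<subseteq> Y \<and> (\<forall>a\<in>X. \<forall>b\<in>X. \<exists>ps. manhattan_path Y a b ps)"

text \<open>For finite \<open>X\<close> the minimum ranges over a nonempty set, since the grid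
  \<open>fst ` X \<times> snd ` X\<close> is a network.\<close>

definition OPT_M :: "point set \<Rightarrow> nat" where
  "OPT_M X = (LEAST k. \<exists>Y. finite Y \<and> manhattan_network X Y \<and> card Y = k)"

text \<open>The point set itself may follow any law on any probability space; only its relative
  ordering is required to be a random variable, and that variable is uniform.\<close>

definition uniformly_ordered_points :: "nat \<Rightarrow> 'w measure \<Rightarrow> ('w \<Rightarrow> point set) \<Rightarrow> bool" where
  "uniformly_ordered_points n M X \<longleftrightarrow>
     prob_space M \<and>
     (\<forall>\<omega>\<in>space M. finite (X \<omega>) \<and> card (X \<omega>) = n \<and> general_position (X \<omega>)) \<and>
     (\<lambda>\<omega>. relative_ordering (X \<omega>)) \<in> measurable M (count_space UNIV) \<and>
     distr M (count_space UNIV) (\<lambda>\<omega>. relative_ordering (X \<omega>)) =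
       measure_pmf (pmf_of_set (permutations_of_set {1..n}))"

end

theory Submission
  imports Defs
begin

text \<open>Monotone changes of the two coordinates preserve manhattan networks, so the optimum depends only
  on the relative ordering and can be computed on the grid of the permutation.  A separator line
  at a dyadic rank for each pair gives the \<open>O (n log n)\<close> upper bound for every permutation.

  The lower bound is Wilber's first bound: for every dyadic block of \<open>x\<close>-ranks, count the points of
  its left half whose successor, in \<open>y\<close>-order within the block, lies in the right half.  A path
  joining such a pair has a horizontal step across the middle of the block, and all these steps
  can be charged to distinct points of the network.  In a random permutation all
  \<open>m (m - 1)\<close> ordered pairs of a block of size \<open>m\<close> are equally likely to be successive, so
  about \<open>m / 4\<close> crossings are expected, which sums to order \<open>n\<close> on each of the \<open>log n\<close> levels.\<close>

section \<open>Manhattan paths and monotone coordinate changes\<close>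

lemma monotone_list_sublist:
  assumes "monotone_list (us @ xs @ vs @ xs @ ws)"
  shows "monotone_list (us @ xs @ ws)"
  using assms unfolding monotone_list_def by (auto simp: sorted_wrt_append)

text \<open>A repeated point encloses a loop, and cutting it out preserves all other conditions.
  Later constructions may therefore list points that happen to coincide.\<close>

lemma manhattan_path_without_distinct:
  assumes "ps \<noteq> []" "hd ps = a" "last ps = b" "set ps \<subseteq> B" "successively axis_aligned ps"
    "monotone_list (map fst ps)" "monotone_list (map snd ps)"
  shows "\<exists>qs. manhattan_path B a b qs"
  using assms
proof (induction "length ps" arbitrary: ps rule: less_induct)
  case less
  show ?case
  proof (cases "distinct ps")
    case True
    then show ?thesis using less.prems unfolding manhattan_path_def by blast
  next
    case False
    then obtain us vs ws x where ps: "ps = us @ [x] @ vs @ [x] @ ws"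
      using not_distinct_decomp by blast
    let ?qs = "us @ [x] @ ws"
    show ?thesis
    proof (rule less.hyps[of ?qs])
      show "length ?qs < length ps" by (simp add: ps)
      show "hd ?qs = a" using less.prems(2) by (cases us) (auto simp: ps)
      show "last ?qs = b" using less.prems(3) by (cases ws) (auto simp: ps)
      show "set ?qs \<subseteq> B" using less.prems(4) by (auto simp: ps)
      show "successively axis_aligned ?qs"
        using less.prems(5) by (auto simp: ps successively_append_iff successively_Cons)
      show "monotone_list (map fst ?qs)" "monotone_list (map snd ?qs)"
        using less.prems(6,7)
          monotone_list_sublist[of "map fst us" "[fst x]" "map fst vs" "map fst ws"]
          monotone_list_sublist[of "map snd us" "[snd x]" "map snd vs" "map snd ws"]
        by (simp_all add: ps)
    qed simp
  qed
qed

lemma monotone_list_map: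
  assumes "mono f" "monotone_list xs"
  shows "monotone_list (map f xs)"
proof -
  have "sorted_wrt (\<le>) xs \<Longrightarrow> sorted_wrt (\<le>) (map f xs)"
    unfolding sorted_wrt_map by (erule sorted_wrt_mono_rel[rotated]) (rule monoD[OF assms(1)])
  moreover have "sorted_wrt (\<ge>) xs \<Longrightarrow> sorted_wrt (\<ge>) (map f xs)"
    unfolding sorted_wrt_map by (erule sorted_wrt_mono_rel[rotated]) (rule monoD[OF assms(1)])
  ultimately show ?thesis using assms(2) unfolding monotone_list_def by blast
qed

text \<open>The maps may be only weakly monotone and merge points of a path; its image is a path
  again once loops are cut out.\<close>

lemma manhattan_network_map_prod:
  assumes "mono f" "mono g" "manhattan_network X Y"
  shows "manhattan_network (map_prod f g ` X) (map_prod f g ` Y)"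
  unfolding manhattan_network_def
proof (intro conjI ballI)
  show "map_prod f g ` X \<subseteq> map_prod f g ` Y"
    using assms(3) unfolding manhattan_network_def by blast
next
  fix a' b' assume in_image: "a' \<in> map_prod f g ` X" "b' \<in> map_prod f g ` X"
  obtain a where a: "a' = map_prod f g a" "a \<in> X" using in_image(1) by (rule imageE)
  obtain b where b: "b' = map_prod f g b" "b \<in> X" using in_image(2) by (rule imageE)
  obtain ps where ps: "manhattan_path Y a b ps"
    using assms(3) a(2) b(2) unfolding manhattan_network_def by blast
  show "\<exists>ps. manhattan_path (map_prod f g ` Y) a' b' ps"
  proof (rule manhattan_path_without_distinct)
    let ?qs = "map (map_prod f g) ps"
    show "?qs \<noteq> []" "hd ?qs = a'" "last ?qs = b'" "set ?qs \<subseteq> map_prod f g ` Y"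
      using ps a(1) b(1) unfolding manhattan_path_def by (simp_all add: hd_map last_map image_mono)
    have "successively axis_aligned ps" using ps unfolding manhattan_path_def by blast
    then show "successively axis_aligned ?qs" unfolding successively_map
      by (rule successively_mono) (auto simp: axis_aligned_def)
    have "monotone_list (map f (map fst ps))" "monotone_list (map g (map snd ps))"
      using ps monotone_list_map assms(1,2) unfolding manhattan_path_def by blast+
    then show "monotone_list (map fst ?qs)" "monotone_list (map snd ?qs)"
      by (simp_all add: comp_def)
  qed
qed

section \<open>The optimum as an attained minimum\<close>

lemma OPT_M_attained:
  assumes "finite Y0" "manhattan_network X Y0"
  shows "\<exists>Y. finite Y \<and> manhattan_network X Y \<and> card Y = OPT_M X"
  unfolding OPT_M_def
  by (rule LeastI[where P = "\<lambda>k. \<exists>Y. finite Y \<and> manhattan_network X Y \<and> card Y = k"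
        and k = "card Y0"]) (use assms in blast)

lemma OPT_M_le:
  assumes "finite Y" "manhattan_network X Y"
  shows "OPT_M X \<le> card Y"
  unfolding OPT_M_def by (rule Least_le) (use assms in blast)

text \<open>The image of an optimal network is a network for the image and has no more points. The
  finite network \<open>Y\<close> guarantees that the optimum is attained.\<close>

lemma OPT_M_map_prod_le:
  assumes "mono f" "mono g" "finite Y" "manhattan_network X Y"
  shows "OPT_M (map_prod f g ` X) \<le> OPT_M X"
proof -
  obtain Z where Z: "finite Z" "manhattan_network X Z" "card Z = OPT_M X"
    using OPT_M_attained[OF assms(3,4)] by blast
  have "OPT_M (map_prod f g ` X) \<le> card (map_prod f g ` Z)"
    using Z manhattan_network_map_prod[OF assms(1,2)] by (intro OPT_M_le) auto
  also have "\<dots> \<le> card Z" using Z(1) by (rule card_image_le)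
  finally show ?thesis using Z(3) by simp
qed

lemma mono_interpolation:
  fixes f g :: "nat \<Rightarrow> real"
  assumes "\<And>i j. i < n \<Longrightarrow> j < n \<Longrightarrow> f i \<le> f j \<Longrightarrow> g i \<le> g j"
  shows "\<exists>h. mono h \<and> (\<forall>i<n. h (f i) = g i)"
proof -
  define D where "D x = insert (Min (g ` {..<n})) (g ` {i. i < n \<and> f i \<le> x})" for x
  have fin: "finite (D x)" for x by (simp add: D_def)
  have "mono (\<lambda>x. Max (D x))"
  proof (rule monoI)
    fix x y :: real assume "x \<le> y"
    then have "D x \<subseteq> D y" by (auto simp: D_def)
    then show "Max (D x) \<le> Max (D y)" using fin by (intro Max_mono) (auto simp: D_def)
  qed
  moreover have "Max (D (f i)) = g i" if "i < n" for i
    using that assms by (intro Max_eqI fin) (auto simp: D_def intro!: Min_le)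
  ultimately show ?thesis by blast
qed

section \<open>The permutation grid\<close>

definition grid :: "nat list \<Rightarrow> point set" where
  "grid xs = (\<lambda>i. (real (xs ! i), real i)) ` {..<length xs}"

lemma (in linorder) set_sorted_key_list_of_set_inj:
  assumes "inj_on f A" "finite A"
  shows "set (sorted_key_list_of_set f A) = A"
proof -
  interpret folding_insort_key "(\<le>)" "(<)" A f using assms(1) by unfold_locales
  show ?thesis using set_sorted_key_list_of_set[OF subset_refl assms(2)] .
qed

lemma (in linorder) strict_sorted_key_list_of_set_inj:
  assumes "inj_on f A"
  shows "sorted_wrt (<) (map f (sorted_key_list_of_set f A))"
proof -
  interpret folding_insort_key "(\<le>)" "(<)" A f using assms by unfold_locales
  show ?thesis using strict_sorted_key_list_of_set[OF subset_refl] .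
qed

text \<open>Sorting by \<open>snd\<close> matches points with list positions, and ranks are ordered
  as the x-coordinates are, so each coordinate can be interpolated monotonically both ways. Each
  direction yields one inequality between the optima.\<close>

lemma relative_ordering_grid:
  assumes "finite X" "general_position X"
  shows "\<exists>f g f' g'. mono f \<and> mono g \<and> mono f' \<and> mono g' \<and>
    map_prod f g ` X = grid (relative_ordering X) \<and>
    map_prod f' g' ` grid (relative_ordering X) = X"
proof -
  define ps where "ps = sorted_key_list_of_set snd X"
  define n where "n = length ps"
  define xs where "xs = relative_ordering X"
  have inj: "inj_on snd X" using assms(2) by (simp add: general_position_def)
  have set_ps: "set ps = X"
    unfolding ps_def by (rule set_sorted_key_list_of_set_inj[OF inj assms(1)])
  have srt: "sorted_wrt (<) (map snd ps)"
    unfolding ps_def by (rule strict_sorted_key_list_of_set_inj[OF inj])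
  have X: "X = (\<lambda>i. ps ! i) ` {..<n}"
    using set_ps by (auto simp: n_def set_conv_nth)
  have len: "length xs = n" by (simp add: xs_def relative_ordering_def n_def ps_def)
  have xs_nth: "xs ! i = card {q \<in> X. fst q \<le> fst (ps ! i)}" if "i < n" for i
    using that by (simp add: xs_def relative_ordering_def n_def ps_def)
  have snd_less: "snd (ps ! i) < snd (ps ! j)" if "i < j" "j < n" for i j
    using sorted_wrt_nth_less[OF srt, of i j] that by (simp add: n_def)
  have snd_iff: "snd (ps ! i) \<le> snd (ps ! j) \<longleftrightarrow> real i \<le> real j"
    if "i < n" "j < n" for i j
    using snd_less[of i j] snd_less[of j i] that by (cases i j rule: linorder_cases) auto
  have fst_less: "xs ! i < xs ! j" if "i < n" "j < n" "fst (ps ! i) < fst (ps ! j)" for i j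
    unfolding xs_nth[OF that(1)] xs_nth[OF that(2)]
  proof (rule psubset_card_mono)
    show "finite {q \<in> X. fst q \<le> fst (ps ! j)}" using assms(1) by simp
    have "ps ! j \<in> X" using that(2) X by blast
    then show "{q \<in> X. fst q \<le> fst (ps ! i)} \<subset> {q \<in> X. fst q \<le> fst (ps ! j)}"
      using that(3) by force
  qed
  have fst_iff: "fst (ps ! i) \<le> fst (ps ! j) \<longleftrightarrow> real (xs ! i) \<le> real (xs ! j)"
    if "i < n" "j < n" for i j
    using fst_less[of i j] fst_less[of j i] that xs_nth
    by (cases "fst (ps ! i)" "fst (ps ! j)" rule: linorder_cases) auto
  obtain f where f: "mono f" "\<And>i. i < n \<Longrightarrow> f (fst (ps ! i)) = real (xs ! i)"
    using mono_interpolation[of n "\<lambda>i. fst (ps ! i)" "\<lambda>i. real (xs ! i)"] fst_iff by auto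
  obtain g where g: "mono g" "\<And>i. i < n \<Longrightarrow> g (snd (ps ! i)) = real i"
    using mono_interpolation[of n "\<lambda>i. snd (ps ! i)" "\<lambda>i. real i"] snd_iff by auto
  obtain f' where f': "mono f'" "\<And>i. i < n \<Longrightarrow> f' (real (xs ! i)) = fst (ps ! i)"
    using mono_interpolation[of n "\<lambda>i. real (xs ! i)" "\<lambda>i. fst (ps ! i)"] fst_iff by auto
  obtain g' where g': "mono g'" "\<And>i. i < n \<Longrightarrow> g' (real i) = snd (ps ! i)"
    using mono_interpolation[of n "\<lambda>i. real i" "\<lambda>i. snd (ps ! i)"] snd_iff by auto
  have "map_prod f g ` X = grid xs"
    unfolding X grid_def len image_image
    by (intro image_cong) (auto simp: f g map_prod_def split_beta)
  moreover have "map_prod f' g' ` grid xs = X"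
    unfolding X grid_def len image_image by (intro image_cong) (auto simp: f' g')
  ultimately show ?thesis using f(1) g(1) f'(1) g'(1) unfolding xs_def by blast
qed

section \<open>Upper bound\<close>

text \<open>Both numbers are halved as long as the halves differ. Once the halves agree, the numbers
  are \<open>2 * c\<close> and \<open>2 * c + 1\<close> for some \<open>c\<close>, and
  \<open>j = 0\<close> works.\<close>

lemma dyadic_separator:
  fixes a b :: nat
  assumes "a < b"
  shows "\<exists>j. a div 2 ^ j + 1 = b div 2 ^ j"
  using assms
proof (induction b arbitrary: a rule: less_induct)
  case (less b)
  show ?case
  proof (cases "a div 2 < b div 2")
    case True
    then obtain j where "a div 2 div 2 ^ j + 1 = b div 2 div 2 ^ j"
      using less.IH[of "b div 2" "a div 2"] less.prems by fastforce
    then show ?thesis by (intro exI[of _ "Suc j"]) (simp add: div_mult2_eq)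
  next
    case False
    then have "a + 1 = b" using less.prems by presburger
    then show ?thesis by (intro exI[of _ 0]) simp
  qed
qed

text \<open>By the previous lemma, ranks \<open>a < b\<close> are separated by a multiple of some \<open>2 ^ j\<close> that is
  both the next one above \<open>a\<close> and the last one up to \<open>b\<close>.  So it suffices to project each point to
  the two multiples of \<open>2 ^ j\<close> around its rank, for each \<open>j\<close>.\<close>

definition dyadic_network :: "nat \<Rightarrow> nat list \<Rightarrow> point set" where
  "dyadic_network J xs =
     (\<lambda>(i, j, e). (real ((xs ! i div 2 ^ j + e) * 2 ^ j), real i)) `
       ({..<length xs} \<times> {..J} \<times> {0, 1})"

lemma finite_dyadic_network: "finite (dyadic_network J xs)"
  by (simp add: dyadic_network_def)

lemma card_dyadic_network_le: "card (dyadic_network J xs) \<le> 2 * (length xs * (J + 1))"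
proof -
  have "card (dyadic_network J xs) \<le> card ({..<length xs} \<times> {..J} \<times> {0, 1 :: nat})"
    unfolding dyadic_network_def by (rule card_image_le) simp
  then show ?thesis by (simp add: algebra_simps)
qed

lemma manhattan_path_rev:
  assumes "manhattan_path Y a b ps"
  shows "manhattan_path Y b a (rev ps)"
proof -
  have "(\<lambda>x y. axis_aligned y x) = axis_aligned"
    by (auto simp: axis_aligned_def fun_eq_iff)
  then have "successively axis_aligned (rev ps) = successively axis_aligned ps"
    by (simp only: successively_rev)
  moreover have "monotone_list (map f (rev ps)) = monotone_list (map f ps)" for f :: "point \<Rightarrow> real"
    by (auto simp: monotone_list_def rev_map[symmetric] sorted_wrt_rev)
  ultimately show ?thesis using assms by (simp add: manhattan_path_def hd_rev last_rev)
qed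

text \<open>From the smaller rank a path goes horizontally to the separating line, along it to the
  other row, and horizontally to its target. Reversal serves pairs of decreasing rank.\<close>

lemma manhattan_network_dyadic:
  assumes "\<And>i. i < length xs \<Longrightarrow> xs ! i < 2 ^ (J + 1)" "distinct xs"
  shows "manhattan_network (grid xs) (dyadic_network J xs)"
proof -
  let ?Y = "dyadic_network J xs"
  let ?p = "\<lambda>i. (real (xs ! i), real i)"
  have sub: "?p i \<in> ?Y" if "i < length xs" for i
    unfolding dyadic_network_def using that by (intro image_eqI[of _ _ "(i, 0, 0)"]) auto
  have path: "\<exists>ps. manhattan_path ?Y (?p i) (?p k) ps"
    if ik: "i < length xs" "k < length xs" "xs ! i < xs ! k" for i k
  proof -
    obtain j where j: "xs ! i div 2 ^ j + 1 = xs ! k div 2 ^ j"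
      using dyadic_separator[OF ik(3)] by blast
    \<comment> \<open>The quotient of \<open>xs ! k\<close> is positive, which keeps the level of
      the separator within those of the network.\<close>
    have "2 ^ j \<le> xs ! k"
      using j by (metis add_gr_0 div_less linorder_not_le less_one neq0_conv)
    then have "(2::nat) ^ j < 2 ^ (J + 1)" using assms(1)[OF ik(2)] by linarith
    then have "j < J + 1" by (rule power_less_imp_less_exp[rotated]) simp
    then have J: "j \<le> J" by simp
    \<comment> \<open>Seen from \<open>i\<close> this line is the projection with
      \<open>e = 1\<close>, seen from \<open>k\<close> the one with \<open>e = 0\<close>.\<close>
    define m where "m = (xs ! k div 2 ^ j) * 2 ^ j"
    have m1: "m = (xs ! i div 2 ^ j + 1) * 2 ^ j" using j by (simp add: m_def)
    have "xs ! i < m" unfolding m1 using dividend_less_div_times[of "2 ^ j" "xs ! i"] by simp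
    moreover have "m \<le> xs ! k" by (simp add: m_def)
    ultimately have m: "real (xs ! i) \<le> real m" "real m \<le> real (xs ! k)" by simp_all
    let ?a = "(real m, real i)" and ?b = "(real m, real k)"
    have "?a \<in> ?Y" unfolding dyadic_network_def m1 using ik J
      by (intro image_eqI[of _ _ "(i, j, 1)"]) (auto simp: algebra_simps)
    moreover have "?b \<in> ?Y" unfolding dyadic_network_def m_def using ik J
      by (intro image_eqI[of _ _ "(k, j, 0)"]) auto
    ultimately show ?thesis using sub ik m
      by (intro manhattan_path_without_distinct[where ps = "[?p i, ?a, ?b, ?p k]"])
        (auto simp: axis_aligned_def monotone_list_def)
  qed
  have "\<exists>ps. manhattan_path ?Y (?p i) (?p k) ps" if ik: "i < length xs" "k < length xs" for i k
  proof (cases "xs ! i" "xs ! k" rule: linorder_cases)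
    case less
    then show ?thesis using path ik by blast
  next
    case equal
    then have "i = k" using assms(2) ik by (simp add: nth_eq_iff_index_eq)
    then have "manhattan_path ?Y (?p i) (?p k) [?p i]"
      using sub[OF ik(1)] by (auto simp: manhattan_path_def monotone_list_def)
    then show ?thesis by blast
  next
    case greater
    then show ?thesis using path[of k i] manhattan_path_rev ik by blast
  qed
  then show ?thesis unfolding manhattan_network_def grid_def using sub by auto
qed

section \<open>Lower bound\<close>

text \<open>For \<open>a\<close> and \<open>b\<close> in \<open>B\<close> and distinct entries,
  \<open>b\<close> is the direct successor of \<open>a\<close> once \<open>xs\<close> is restricted
  to \<open>B\<close>.\<close>

definition adjacent_in :: "nat set \<Rightarrow> nat list \<Rightarrow> nat \<Rightarrow> nat \<Rightarrow> bool" where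
  "adjacent_in B xs a b \<longleftrightarrow> (\<exists>i j. i < j \<and> j < length xs \<and> xs ! i = a \<and> xs ! j = b \<and>
     (\<forall>k. i < k \<and> k < j \<longrightarrow> xs ! k \<notin> B))"

text \<open>The level \<open>j\<close> is that of the halves, so a block has
  \<open>2 ^ (j + 1)\<close> ranks. The intervals are open on the left because ranks start at
  1.\<close>

definition left_half :: "nat \<Rightarrow> nat \<Rightarrow> nat set" where
  "left_half j b = {2 * b * 2 ^ j <.. (2 * b + 1) * 2 ^ j}"

definition right_half :: "nat \<Rightarrow> nat \<Rightarrow> nat set" where
  "right_half j b = {(2 * b + 1) * 2 ^ j <.. (2 * b + 2) * 2 ^ j}"

text \<open>Only changes from left to right are counted. Changes of side alternate in direction, so
  this costs about a factor of two.\<close>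

definition crossings :: "nat \<Rightarrow> nat \<Rightarrow> nat list \<Rightarrow> (nat \<times> nat) set" where
  "crossings j b xs = {(u, v) \<in> left_half j b \<times> right_half j b.
     adjacent_in (left_half j b \<union> right_half j b) xs u v}"

section \<open>Relative position of dyadic blocks\<close>

text \<open>The midpoint of the larger block is a multiple of the length of the smaller one. The
  smaller block extends beyond this midpoint, so by alignment it starts there or later. The point is
  real since network points need not have integer coordinates.\<close>

lemma right_halves_nested:
  fixes t :: real
  assumes "real ((2 * b + 1) * 2 ^ j) < t" "t \<le> real ((2 * b + 2) * 2 ^ j)"
    and "real ((2 * b' + 1) * 2 ^ j') < t" "t \<le> real ((2 * b' + 2) * 2 ^ j')"
    and "j' < j"
  shows "(2 * b + 1) * 2 ^ j \<le> 2 * b' * 2 ^ j'"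
proof -
  obtain d where d: "j = j' + Suc d" using assms(5) less_iff_Suc_add by auto
  have "real ((2 * b + 1) * 2 ^ j) < real ((2 * b' + 2) * 2 ^ j')" using assms by linarith
  then have "(2 * b + 1) * 2 ^ j < (2 * b' + 2) * 2 ^ j'" by (simp only: of_nat_less_iff)
  then have "(2 * ((2 * b + 1) * 2 ^ d)) * 2 ^ j' < (2 * (b' + 1)) * (2 :: nat) ^ j'"
    by (simp add: d power_add algebra_simps)
  then have "(2 * b + 1) * 2 ^ d \<le> b'" by (simp only: mult_less_cancel2) auto
  then have "(2 * ((2 * b + 1) * 2 ^ d)) * 2 ^ j' \<le> (2 * b') * (2 :: nat) ^ j'"
    by (intro mult_le_mono1 mult_le_mono2)
  then show ?thesis by (simp add: d power_add algebra_simps)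
qed

lemma right_halves_equal:
  fixes t :: real
  assumes "real ((2 * b + 1) * 2 ^ j) < t" "t \<le> real ((2 * b + 2) * 2 ^ j)"
    and "real ((2 * b' + 1) * 2 ^ j) < t" "t \<le> real ((2 * b' + 2) * 2 ^ j)"
  shows "b = b'"
proof -
  have "real ((2 * b + 1) * 2 ^ j) < real ((2 * b' + 2) * 2 ^ j)"
    "real ((2 * b' + 1) * 2 ^ j) < real ((2 * b + 2) * 2 ^ j)" using assms by linarith+
  then have "(2 * b + 1) * 2 ^ j < (2 * b' + 2) * 2 ^ j"
     "(2 * b' + 1) * 2 ^ j < (2 * b + 2) * 2 ^ j" by (simp_all only: of_nat_less_iff)
  then have "2 * b + 1 < 2 * b' + 2" "2 * b' + 1 < 2 * b + 2" by (simp_all only: mult_less_cancel2)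
  then show ?thesis by linarith
qed

section \<open>Paths across a vertical line\<close>

text \<open>A discrete intermediate value argument: the step that first passes \<open>c\<close>
  changes the x-coordinate, so axis alignment makes it horizontal.\<close>

lemma crossing_step:
  assumes "ps \<noteq> []" "successively axis_aligned ps" "fst (hd ps) \<le> c" "c < fst (last ps)"
  shows "\<exists>s\<in>set ps. \<exists>t\<in>set ps. fst s \<le> c \<and> c < fst t \<and> snd s = snd t"
  using assms
proof (induction ps rule: induct_list012)
  case (3 x y zs)
  show ?case
  proof (cases "fst y \<le> c")
    case True
    then have "\<exists>s\<in>set (y # zs). \<exists>t\<in>set (y # zs). fst s \<le> c \<and> c < fst t \<and> snd s = snd t"
      using "3.prems" by (intro "3.IH"(2)) auto
    then show ?thesis by (meson list.set_intros(2))
  next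
    case False
    then have "snd x = snd y" using "3.prems" by (auto simp: axis_aligned_def)
    then show ?thesis using False "3.prems"(3) by (intro bexI[of _ x] bexI[of _ y]) auto
  qed
qed auto

text \<open>A head strictly below the last entry rules out decreasing order. Applied to both
  coordinates, this confines a path to the rectangle spanned by its ends.\<close>

lemma monotone_list_bounds:
  assumes "monotone_list zs" "zs \<noteq> []" "hd zs < last zs" "z \<in> set zs"
  shows "hd zs \<le> z \<and> z \<le> last zs"
proof -
  have hd: "hd zs = z \<or> R (hd zs) z" and last: "z = last zs \<or> R z (last zs)"
    if "sorted_wrt R zs" for R
  proof -
    obtain us vs where zs: "zs = us @ z # vs" using assms(4) by (meson split_list)
    show "hd zs = z \<or> R (hd zs) z"
      using that by (cases us) (auto simp: zs sorted_wrt_append)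
    show "z = last zs \<or> R z (last zs)"
      using that by (cases vs rule: rev_cases) (auto simp: zs sorted_wrt_append)
  qed
  show ?thesis
    using assms(1,3) hd[of "(\<le>)"] last[of "(\<le>)"] hd[of "(\<ge>)"] last[of "(\<ge>)"]
    unfolding monotone_list_def by auto
qed

text \<open>Each crossing is charged to the leftmost point of \<open>Y\<close> to the right of the dividing line in a
  row where the path crosses that line.  A dyadic block whose right half also contains this point
  either is nested strictly inside the right half, in which case its own crossing segment would
  start further left in the same row, or is the block itself; there, distinct crossings occupy
  disjoint sets of rows.\<close>

definition charged_at ::
  "point set \<Rightarrow> nat list \<Rightarrow> nat \<Rightarrow> nat \<Rightarrow> nat \<Rightarrow> nat \<Rightarrow> nat \<Rightarrow> nat \<Rightarrow> point \<Rightarrow> bool" where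
  "charged_at Y xs j b u v i k t \<longleftrightarrow> i < k \<and> xs ! i = u \<and> xs ! k = v \<and>
    (\<forall>l. i < l \<longrightarrow> l < k \<longrightarrow> xs ! l \<notin> left_half j b \<union> right_half j b) \<and>
    t \<in> Y \<and> real i \<le> snd t \<and> snd t \<le> real k \<and> real ((2 * b + 1) * 2 ^ j) < fst t \<and>
    fst t \<le> real ((2 * b + 2) * 2 ^ j) \<and>
    (\<exists>s\<in>Y. snd s = snd t \<and> real (2 * b * 2 ^ j) < fst s \<and> fst s \<le> real ((2 * b + 1) * 2 ^ j)) \<and>
    (\<forall>t'\<in>Y. snd t' = snd t \<longrightarrow> real ((2 * b + 1) * 2 ^ j) < fst t' \<longrightarrow> fst t \<le> fst t')"

text \<open>A path joining the two grid points stays in their rectangle, so its step across the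
  midline lies within the block and in a row between \<open>i\<close> and \<open>k\<close>.\<close>

lemma crossing_charged:
  assumes "finite Y" "manhattan_network (grid xs) Y" "(u, v) \<in> crossings j b xs"
  shows "\<exists>i k t. charged_at Y xs j b u v i k t"
proof -
  let ?lo = "2 * b * 2 ^ j" and ?mid = "(2 * b + 1) * 2 ^ j" and ?hi = "(2 * b + 2) * 2 ^ j"
  from assms(3) have "u \<in> left_half j b" "v \<in> right_half j b"
    "adjacent_in (left_half j b \<union> right_half j b) xs u v" by (simp_all add: crossings_def)
  then obtain i k where ik: "i < k" "k < length xs" "xs ! i = u" "xs ! k = v"
    and gap: "\<And>l. i < l \<Longrightarrow> l < k \<Longrightarrow> xs ! l \<notin> left_half j b \<union> right_half j b"
    unfolding adjacent_in_def by blast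
  have "?lo < u" "u \<le> ?mid" "?mid < v" "v \<le> ?hi"
    using \<open>u \<in> left_half j b\<close> \<open>v \<in> right_half j b\<close> by (simp_all add: left_half_def right_half_def)
  then have uv: "real ?lo < real u" "real u \<le> real ?mid" "real ?mid < real v" "real v \<le> real ?hi"
    by (simp_all only: of_nat_less_iff of_nat_le_iff)
  let ?p = "(real u, real i)" and ?q = "(real v, real k)"
  have "?p \<in> grid xs" "?q \<in> grid xs" unfolding grid_def using ik by force+
  then obtain ps where "manhattan_path Y ?p ?q ps"
    using assms(2) unfolding manhattan_network_def by blast
  then have ps: "ps \<noteq> []" "hd ps = ?p" "last ps = ?q" "set ps \<subseteq> Y" "successively axis_aligned ps"
    "monotone_list (map fst ps)" "monotone_list (map snd ps)"
    unfolding manhattan_path_def by auto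
  have box: "real u \<le> fst z \<and> fst z \<le> real v" "real i \<le> snd z \<and> snd z \<le> real k"
    if "z \<in> set ps" for z
  proof -
    have "real u < real v" "real i < real k" using uv ik by auto
    then show "real u \<le> fst z \<and> fst z \<le> real v" "real i \<le> snd z \<and> snd z \<le> real k"
      using monotone_list_bounds[OF ps(6), of "fst z"] monotone_list_bounds[OF ps(7), of "snd z"]
        ps(1-3) that by (auto simp: hd_map last_map)
  qed
  obtain s r where sr: "s \<in> set ps" "r \<in> set ps" "fst s \<le> real ?mid" "real ?mid < fst r"
      "snd s = snd r"
    using crossing_step[OF ps(1,5), of "real ?mid"] ps(2,3) uv by auto
  \<comment> \<open>The right end \<open>r\<close> of the step need not be the leftmost network
    point beyond the midline in its row. The charged point is, and comparison with \<open>r\<close>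
    keeps it inside the block.\<close>
  define T where "T = {t \<in> Y. snd t = snd r \<and> real ?mid < fst t}"
  have "finite T" "r \<in> T" using assms(1) sr ps(4) by (auto simp: T_def)
  then have "Min (fst ` T) \<in> fst ` T" by (intro Min_in) auto
  then obtain t where t: "t \<in> T" "fst t = Min (fst ` T)" by (metis imageE)
  have t_le: "fst t \<le> fst t'" if "t' \<in> T" for t'
    unfolding t(2) using \<open>finite T\<close> that by (intro Min_le) auto
  have "fst t \<le> real ?hi" using t_le[OF \<open>r \<in> T\<close>] box(1)[OF sr(2)] uv(4) by linarith
  moreover have "real ?lo < fst s" using box(1)[OF sr(1)] uv(1) by linarith
  then have "\<exists>s\<in>Y. snd s = snd t \<and> real ?lo < fst s \<and> fst s \<le> real ?mid"
    using sr ps(4) t(1) by (intro bexI[of _ s]) (auto simp: T_def)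
  moreover have "t \<in> Y" "real ?mid < fst t" "real i \<le> snd t" "snd t \<le> real k"
    using t(1) box(2)[OF sr(2)] by (auto simp: T_def)
  moreover have "\<forall>t'\<in>Y. snd t' = snd t \<longrightarrow> real ?mid < fst t' \<longrightarrow> fst t \<le> fst t'"
    using t_le t(1) by (auto simp: T_def)
  ultimately have "charged_at Y xs j b u v i k t"
    unfolding charged_at_def using ik(1,3,4) gap by blast
  then show ?thesis by blast
qed

text \<open>Choosing a charged point for every crossing of every block in \<open>V\<close> gives an
  injection into \<open>Y\<close>.\<close>

lemma sum_card_crossings_le:
  assumes "finite V" "finite Y" "manhattan_network (grid xs) Y"
  shows "(\<Sum>(j, b)\<in>V. card (crossings j b xs)) \<le> card Y"
proof -
  let ?mid = "\<lambda>j b. real ((2 * b + 1) * 2 ^ j)"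
  define D where "D = Sigma V (\<lambda>(j, b). crossings j b xs)"
  have fin: "finite (crossings j b xs)" for j b
    by (rule finite_subset[of _ "left_half j b \<times> right_half j b"])
      (auto simp: crossings_def left_half_def right_half_def)
  have "\<exists>t i k. charged_at Y xs (fst (fst d)) (snd (fst d)) (fst (snd d)) (snd (snd d)) i k t"
    if "d \<in> D" for d
  proof -
    obtain j b u v where d: "d = ((j, b), (u, v))" by (metis surj_pair)
    then have "(u, v) \<in> crossings j b xs" using that by (simp add: D_def)
    from crossing_charged[OF assms(2,3) this]
    show ?thesis unfolding d fst_conv snd_conv by blast
  qed
  then obtain T where T: "\<And>d. d \<in> D \<Longrightarrow>
      \<exists>i k. charged_at Y xs (fst (fst d)) (snd (fst d)) (fst (snd d)) (snd (snd d)) i k (T d)"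
    by metis
  have nested: False
    if Q: "charged_at Y xs j b u v i k t" "charged_at Y xs j' b' u' v' i' k' t" and "j' < j"
    for j b u v i k t j' b' u' v' i' k'
  proof -
    have "(2 * b + 1) * 2 ^ j \<le> 2 * b' * 2 ^ j'"
      using right_halves_nested[of b j "fst t" b' j'] Q \<open>j' < j\<close> unfolding charged_at_def by blast
    then have le: "?mid j b \<le> real (2 * b' * 2 ^ j')" by (simp only: of_nat_le_iff)
    obtain s where s: "s \<in> Y" "snd s = snd t" "real (2 * b' * 2 ^ j') < fst s" "fst s \<le> ?mid j' b'"
      using Q(2) unfolding charged_at_def by blast
    have "?mid j b < fst s" using s(3) le by linarith
    then have "fst t \<le> fst s" using Q(1) s unfolding charged_at_def by blast
    moreover have "?mid j' b' < fst t" using Q(2) unfolding charged_at_def by blast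
    ultimately show False using s(4) by linarith
  qed
  have halves: "u \<in> left_half j b" "v \<in> right_half j b" if "(u, v) \<in> crossings j b xs" for j b u v
    using that by (auto simp: crossings_def)
  have disjoint: "x \<notin> right_half j b" if "x \<in> left_half j b" for x j b
    using that by (simp add: left_half_def right_half_def)
  \<comment> \<open>Both row intervals contain the row of \<open>t\<close>, so a later start
    \<open>i'\<close> is at most \<open>k\<close>. Strictly before \<open>k\<close>,
    \<open>u'\<close> violates the gap; at \<open>k\<close>, \<open>u' = v\<close> would lie in both
    halves.\<close>
  have starts: "\<not> i < i'"
    if Q: "charged_at Y xs j b u v i k t" "charged_at Y xs j b u' v' i' k' t"
      and c: "(u, v) \<in> crossings j b xs" "(u', v') \<in> crossings j b xs"
    for j b u v i k t u' v' i' k'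
  proof
    assume "i < i'"
    have "real i' \<le> real k" using Q unfolding charged_at_def by linarith
    then have "i' < k \<or> i' = k" by auto
    then show False using Q \<open>i < i'\<close> halves[OF c(1)] halves[OF c(2)] disjoint
      unfolding charged_at_def by blast
  qed
  \<comment> \<open>With a common start, \<open>v\<close> would lie in the gap of the longer
    interval.\<close>
  have ends: "\<not> k < k'"
    if Q: "charged_at Y xs j b u v i k t" "charged_at Y xs j b u' v' i k' t"
      and c: "(u, v) \<in> crossings j b xs"
    for j b u v i k t u' v' k'
    using Q halves[OF c] unfolding charged_at_def by blast
  have "inj_on T D"
  proof (rule inj_onI)
    fix d d' assume dd: "d \<in> D" "d' \<in> D" "T d = T d'"
    obtain j b u v where d: "d = ((j, b), (u, v))" by (metis surj_pair)
    obtain j' b' u' v' where d': "d' = ((j', b'), (u', v'))" by (metis surj_pair)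
    obtain i k where Q: "charged_at Y xs j b u v i k (T d)"
      using T[OF dd(1)] unfolding d fst_conv snd_conv by blast
    obtain i' k' where Q': "charged_at Y xs j' b' u' v' i' k' (T d)"
      using T[OF dd(2)] unfolding dd(3) d' fst_conv snd_conv by blast
    have j: "j = j'" using nested[OF Q Q'] nested[OF Q' Q] by (meson linorder_neqE_nat)
    have b: "b = b'" using right_halves_equal[of b j "fst (T d)" b'] Q Q'
      unfolding j charged_at_def by blast
    have c: "(u, v) \<in> crossings j b xs" "(u', v') \<in> crossings j b xs"
      using dd(1,2) by (auto simp: D_def d d' j b)
    note Q'' = Q'[folded j b]
    have i: "i = i'" using starts[OF Q Q'' c] starts[OF Q'' Q c(2,1)] by linarith
    have "k = k'" using ends[OF Q Q''[folded i] c(1)] ends[OF Q''[folded i] Q c(2)] by linarith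
    then show "d = d'" using Q Q' i by (simp add: d d' j b charged_at_def)
  qed
  moreover have "T ` D \<subseteq> Y"
    using T unfolding charged_at_def by (intro image_subsetI) blast
  ultimately have "card D \<le> card Y" using assms(2) by (rule card_inj_on_le)
  moreover have "card D = (\<Sum>(j, b)\<in>V. card (crossings j b xs))"
    unfolding D_def using assms(1) fin by (subst card_SigmaI) (auto simp: case_prod_unfold)
  ultimately show ?thesis by simp
qed

section \<open>Expected number of crossings\<close>

lemma adjacent_in_map:
  assumes "inj f" "\<And>x. f x \<in> B \<longleftrightarrow> x \<in> B"
  shows "adjacent_in B (map f xs) (f a) (f b) \<longleftrightarrow> adjacent_in B xs a b"
  unfolding adjacent_in_def using assms
  by (intro ex_cong1 conj_cong refl) (auto simp: inj_eq)

text \<open>Exchanging the values \<open>x\<close> and \<open>y\<close> throughout a list is an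
  involution on the permutations of \<open>A\<close>. It preserves membership in \<open>B\<close>,
  so it carries adjacent pairs to adjacent pairs.\<close>

lemma card_adjacent_transpose:
  assumes "B \<subseteq> A" "x \<in> B" "y \<in> B"
  shows "card {xs \<in> permutations_of_set A. adjacent_in B xs (Transposition.transpose x y a)
      (Transposition.transpose x y b)} =
    card {xs \<in> permutations_of_set A. adjacent_in B xs a b}"
proof -
  let ?t = "Transposition.transpose x y"
  have inv: "map ?t (map ?t xs) = xs" for xs by (simp add: comp_def)
  have mem: "?t z \<in> B \<longleftrightarrow> z \<in> B" for z using assms by (auto simp: Transposition.transpose_def)
  have adj: "adjacent_in B (map ?t xs) (?t c) (?t d) \<longleftrightarrow> adjacent_in B xs c d" for xs c d
    using mem by (intro adjacent_in_map) auto
  have perm: "map ?t xs \<in> permutations_of_set A" if "xs \<in> permutations_of_set A" for xs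
  proof -
    have "?t ` A = A" using assms by (auto simp: Transposition.transpose_def image_iff)
    then show ?thesis using that by (auto simp: permutations_of_set_def distinct_map)
  qed
  have "bij_betw (map ?t) {xs \<in> permutations_of_set A. adjacent_in B xs a b}
    {xs \<in> permutations_of_set A. adjacent_in B xs (?t a) (?t b)}"
  proof (rule bij_betw_byWitness[where f' = "map ?t"])
    show "map ?t ` {xs \<in> permutations_of_set A. adjacent_in B xs a b}
        \<subseteq> {xs \<in> permutations_of_set A. adjacent_in B xs (?t a) (?t b)}"
      using perm adj by auto
    show "map ?t ` {xs \<in> permutations_of_set A. adjacent_in B xs (?t a) (?t b)}
        \<subseteq> {xs \<in> permutations_of_set A. adjacent_in B xs a b}"
      using perm adj[of _ "?t a" "?t b"] by auto
  qed (use inv in auto)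
  then show ?thesis by (rule bij_betw_same_card[symmetric])
qed

text \<open>One transposition takes \<open>a\<close> to \<open>c\<close>; a second one takes the
  image of \<open>b\<close> to \<open>d\<close> while fixing \<open>c\<close>.\<close>

lemma card_adjacent_eq:
  assumes "B \<subseteq> A" "a \<in> B" "b \<in> B" "a \<noteq> b" "c \<in> B" "d \<in> B" "c \<noteq> d"
  shows "card {xs \<in> permutations_of_set A. adjacent_in B xs a b} =
    card {xs \<in> permutations_of_set A. adjacent_in B xs c d}"
proof -
  let ?F = "\<lambda>a b. card {xs \<in> permutations_of_set A. adjacent_in B xs a b}"
  let ?b = "Transposition.transpose a c b"
  have b: "?b \<in> B" "?b \<noteq> c" using assms by (auto simp: Transposition.transpose_def)
  have "?F a b = ?F c ?b" using card_adjacent_transpose[OF assms(1,2,5), of a b] by simp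
  also have "\<dots> = ?F c d"
    using card_adjacent_transpose[OF assms(1) b(1) assms(6), of c ?b] b(2) assms(7)
    by (simp add: transpose_apply_other)
  finally show ?thesis .
qed

text \<open>Every element of \<open>B\<close> except the last one to appear in \<open>xs\<close> has
  a successor within \<open>B\<close>.\<close>

lemma card_adjacent_pairs_ge:
  assumes "xs \<in> permutations_of_set A" "B \<subseteq> A" "finite B"
  shows "card B - 1 \<le>
    card {p \<in> {(a, b). a \<in> B \<and> b \<in> B \<and> a \<noteq> b}. adjacent_in B xs (fst p) (snd p)}"
    (is "_ \<le> card ?P")
proof (cases "B = {}")
  case False
  have xs: "set xs = A" "distinct xs" using assms(1) by (auto simp: permutations_of_set_def)
  define I where "I = {i. i < length xs \<and> xs ! i \<in> B}"
  have "finite I" by (simp add: I_def)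
  have index: "\<exists>i\<in>I. xs ! i = a" if "a \<in> B" for a
    using that assms(2) xs(1) by (fastforce simp: I_def in_set_conv_nth)
  then have "I \<noteq> {}" using False by blast
  define m where "m = Max I"
  have "m \<in> I" unfolding m_def using \<open>finite I\<close> \<open>I \<noteq> {}\<close> by (rule Max_in)
  have "B - {xs ! m} \<subseteq> fst ` ?P"
  proof
    fix a assume a: "a \<in> B - {xs ! m}"
    then obtain i where i: "i \<in> I" "xs ! i = a" using index by blast
    have "i \<le> m" unfolding m_def using \<open>finite I\<close> i(1) by (rule Max_ge)
    moreover have "i \<noteq> m" using i(2) a by blast
    ultimately have ex: "i < m \<and> xs ! m \<in> B" using \<open>m \<in> I\<close> by (simp add: I_def)
    \<comment> \<open>The successor sits at the next position holding an element of
      \<open>B\<close>; position \<open>m\<close> shows that there is one.\<close>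
    define k where "k = (LEAST k. i < k \<and> xs ! k \<in> B)"
    have k: "i < k" "xs ! k \<in> B"
      using LeastI[of "\<lambda>k. i < k \<and> xs ! k \<in> B", OF ex] by (simp_all add: k_def)
    have "k \<le> m" unfolding k_def using ex by (rule Least_le)
    then have "k < length xs" using \<open>m \<in> I\<close> by (simp add: I_def)
    have "xs ! l \<notin> B" if "i < l" "l < k" for l
      using not_less_Least[of l "\<lambda>k. i < k \<and> xs ! k \<in> B"] that by (simp add: k_def)
    then have "adjacent_in B xs a (xs ! k)"
      unfolding adjacent_in_def using k \<open>k < length xs\<close> i(2) by blast
    moreover have "a \<noteq> xs ! k"
      using xs(2) k(1) \<open>k < length xs\<close> i(2) by (auto simp: nth_eq_iff_index_eq)
    ultimately have "(a, xs ! k) \<in> ?P" using a k(2) by simp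
    then show "a \<in> fst ` ?P" by force
  qed
  moreover have fin: "finite ?P" by (rule finite_subset[of _ "B \<times> B"]) (use assms(3) in auto)
  ultimately have "card (B - {xs ! m}) \<le> card ?P"
    by (meson card_image_le card_mono finite_imageI le_trans)
  then show ?thesis using \<open>m \<in> I\<close> assms(3) by (simp add: I_def)
qed simp

text \<open>Double counting: each permutation has at least \<open>card B - 1\<close> adjacent pairs,
  and all \<open>card B * (card B - 1)\<close> ordered pairs occur equally often. So a given pair is
  adjacent with probability at least \<open>1 / card B\<close>.\<close>

lemma card_adjacent_ge:
  assumes "finite A" "B \<subseteq> A" "a \<in> B" "b \<in> B" "a \<noteq> b"
  shows "card (permutations_of_set A) \<le>
    card B * card {xs \<in> permutations_of_set A. adjacent_in B xs a b}"
proof -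
  let ?S = "permutations_of_set A"
  let ?F = "card {xs \<in> ?S. adjacent_in B xs a b}"
  let ?P = "{(a, b). a \<in> B \<and> b \<in> B \<and> a \<noteq> b}"
  have "finite B" using assms(1,2) by (rule finite_subset[rotated])
  have P: "?P = B \<times> B - (\<lambda>x. (x, x)) ` B" by auto
  have finP: "finite ?P" unfolding P using \<open>finite B\<close> by simp
  have "card ?P = card B * card B - card B"
    unfolding P using \<open>finite B\<close>
    by (subst card_Diff_subset) (auto simp: card_image inj_on_def card_cartesian_product)
  then have cardP: "card ?P = card B * (card B - 1)" by (simp add: diff_mult_distrib2)
  \<comment> \<open>Two elements in \<open>B\<close> make the common factor
    \<open>card B - 1\<close> positive, so that it can be cancelled.\<close>
  have "card {a, b} \<le> card B" using \<open>finite B\<close> assms(3,4) by (intro card_mono) auto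
  then have B2: "card B - 1 > 0" using assms(5) by simp
  have "card ?S * (card B - 1) = (\<Sum>xs\<in>?S. card B - 1)" by simp
  also have "\<dots> \<le> (\<Sum>xs\<in>?S. card {p \<in> ?P. adjacent_in B xs (fst p) (snd p)})"
    using card_adjacent_pairs_ge[OF _ assms(2) \<open>finite B\<close>]
    by (intro sum_mono)
  also have "\<dots> = (\<Sum>p\<in>?P. ?F)"
    using card_adjacent_eq[OF assms(2) _ _ _ assms(3-5)] finP
    by (intro sum_multicount_gen) auto
  also have "\<dots> = (card B * ?F) * (card B - 1)" by (simp add: cardP)
  finally show ?thesis using B2 by simp
qed

text \<open>Each of the \<open>2 ^ j * 2 ^ j\<close> pairs from left to right is adjacent with
  probability at least \<open>1 / (2 * 2 ^ j)\<close>, so at least \<open>2 ^ j / 2\<close>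
  crossings are expected.\<close>

lemma sum_card_crossings_ge:
  assumes "(2 * b + 2) * 2 ^ j \<le> n"
  shows "2 ^ j * card (permutations_of_set {1..n}) \<le>
    2 * (\<Sum>xs\<in>permutations_of_set {1..n}. card (crossings j b xs))"
proof -
  let ?S = "permutations_of_set {1..n}"
  let ?L = "left_half j b" and ?R = "right_half j b"
  let ?B = "?L \<union> ?R"
  have sub: "?B \<subseteq> {1..n}"
  proof
    fix x assume x: "x \<in> ?B"
    have "2 * b * 2 ^ j \<le> (2 * b + 1) * 2 ^ j" "(2 * b + 1) * 2 ^ j \<le> (2 * b + 2) * (2::nat) ^ j"
      by (intro mult_le_mono1, simp)+
    then show "x \<in> {1..n}" using x assms by (auto simp only: left_half_def right_half_def Un_iff
      greaterThanAtMost_iff atLeastAtMost_iff)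
  qed
  have card: "card ?L = 2 ^ j" "card ?R = 2 ^ j"
    by (simp_all add: left_half_def right_half_def flip: diff_mult_distrib)
  have disj: "?L \<inter> ?R = {}" by (auto simp: left_half_def right_half_def)
  have fin: "finite ?L" "finite ?R" by (simp_all add: left_half_def right_half_def)
  have "card ?B = 2 * 2 ^ j" using fin disj card by (simp add: card_Un_disjoint)
  obtain x y where xy: "x \<in> ?L" "y \<in> ?R"
    using card by (metis all_not_in_conv card.empty power_eq_0_iff zero_neq_numeral)
  let ?F = "card {xs \<in> ?S. adjacent_in ?B xs x y}"
  have "x \<noteq> y" using xy disj by blast
  then have F: "card ?S \<le> (2 * 2 ^ j) * ?F"
    using card_adjacent_ge[OF _ sub, of x y] xy \<open>card ?B = _\<close> by simp
  have "(\<Sum>xs\<in>?S. card (crossings j b xs)) =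
      (\<Sum>xs\<in>?S. card {p \<in> ?L \<times> ?R. adjacent_in ?B xs (fst p) (snd p)})"
    unfolding crossings_def by (intro sum.cong refl arg_cong[of _ _ card]) auto
  also have "\<dots> = (\<Sum>p\<in>?L \<times> ?R. ?F)"
  proof (rule sum_multicount_gen)
    show "\<forall>p\<in>?L \<times> ?R. card {xs \<in> ?S. adjacent_in ?B xs (fst p) (snd p)} = ?F"
      using disj xy \<open>x \<noteq> y\<close> by (intro ballI card_adjacent_eq[OF sub]) auto
  qed (use fin in auto)
  also have "\<dots> = 2 ^ j * 2 ^ j * ?F" using card by (simp add: card_cartesian_product)
  finally have "2 * (\<Sum>xs\<in>?S. card (crossings j b xs)) = 2 ^ j * ((2 * 2 ^ j) * ?F)" by simp
  then show ?thesis using F by simp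
qed

section \<open>The expectation\<close>

text \<open>Monotone maps in both directions give both inequalities. The product of the coordinate
  sets, with one-bend paths, is the finite network that attainment requires; its image serves for
  the grid.\<close>

lemma OPT_M_relative_ordering:
  assumes "finite X" "general_position X"
  shows "OPT_M X = OPT_M (grid (relative_ordering X))"
proof -
  obtain f g f' g' where fg: "mono f" "mono g" "mono f'" "mono g'"
    and X: "map_prod f g ` X = grid (relative_ordering X)"
      "map_prod f' g' ` grid (relative_ordering X) = X"
    using relative_ordering_grid[OF assms] by metis
  define Y where "Y = fst ` X \<times> snd ` X"
  have "finite Y" using assms(1) by (simp add: Y_def)
  have path: "\<exists>ps. manhattan_path Y a b ps" if "a \<in> X" "b \<in> X" for a b
  proof -
    have "a \<in> Y" "b \<in> Y" "(fst a, snd b) \<in> Y"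
      using that by (auto simp: Y_def mem_Times_iff)
    then show ?thesis
      by (intro manhattan_path_without_distinct[where ps = "[a, (fst a, snd b), b]"])
        (auto simp: axis_aligned_def monotone_list_def)
  qed
  have "X \<subseteq> Y" unfolding Y_def by (rule subset_fst_snd)
  with path have Y: "manhattan_network X Y" by (simp add: manhattan_network_def)
  have "OPT_M (grid (relative_ordering X)) \<le> OPT_M X"
    using OPT_M_map_prod_le[OF fg(1,2) \<open>finite Y\<close> Y] X(1) by simp
  moreover have "OPT_M X \<le> OPT_M (grid (relative_ordering X))"
    using OPT_M_map_prod_le[OF fg(3,4) finite_imageI[OF \<open>finite Y\<close>]
        manhattan_network_map_prod[OF fg(1,2) Y, unfolded X(1)]] X(2) by simp
  ultimately show ?thesis by (rule antisym[rotated])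
qed

section \<open>Bounds by the number of dyadic levels\<close>

lemma permutation_network:
  assumes "xs \<in> permutations_of_set {1..n}" "n < 2 ^ (J + 1)"
  shows "manhattan_network (grid xs) (dyadic_network J xs)"
proof (rule manhattan_network_dyadic)
  have xs: "set xs = {1..n}" "distinct xs" using assms(1) by (auto simp: permutations_of_set_def)
  show "distinct xs" by (fact xs(2))
  show "xs ! i < 2 ^ (J + 1)" if "i < length xs" for i
  proof -
    have "xs ! i \<in> {1..n}" using nth_mem[OF that] xs(1) by blast
    then show ?thesis using assms(2) by simp
  qed
qed

lemma OPT_M_grid_le:
  assumes "xs \<in> permutations_of_set {1..n}" "n < 2 ^ (J + 1)"
  shows "OPT_M (grid xs) \<le> 2 * (n * (J + 1))"
proof -
  have "length xs = n" using assms(1) by (simp add: length_finite_permutations_of_set)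
  then show ?thesis
    using OPT_M_le[OF finite_dyadic_network permutation_network[OF assms]]
      card_dyadic_network_le[of J xs] by simp
qed

text \<open>The half-lengths \<open>2 ^ j\<close> of the complete blocks of one level add up to at
  least \<open>n / 4\<close>, and half of that is expected as crossings. So each of the
  \<open>J\<close> levels contributes at least \<open>n / 8\<close> on average.\<close>

lemma sum_OPT_M_grid_ge:
  assumes "2 ^ J \<le> n" "n < 2 ^ (J + 1)"
  shows "n * J * card (permutations_of_set {1..n}) \<le>
    8 * (\<Sum>xs\<in>permutations_of_set {1..n}. OPT_M (grid xs))"
proof -
  let ?S = "permutations_of_set {1..n}"
  define V where "V = Sigma {..<J} (\<lambda>j. {..<n div 2 ^ (j + 1)})"
  have "finite V" by (simp add: V_def)
  have block: "(2 * b + 2) * 2 ^ j \<le> n" if "(j, b) \<in> V" for j b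
  proof -
    have "(b + 1) * 2 ^ (j + 1) \<le> n div 2 ^ (j + 1) * 2 ^ (j + 1)"
      using that by (intro mult_le_mono1) (simp add: V_def)
    also have "\<dots> \<le> n" by (rule div_times_less_eq_dividend)
    finally show ?thesis by (simp add: algebra_simps)
  qed
  \<comment> \<open>A complete block fits since \<open>j + 1 \<le> J\<close>. The remainder is
    shorter than one block, so the complete blocks cover more than half of the ranks.\<close>
  have level: "n \<le> 4 * (n div 2 ^ (j + 1) * 2 ^ j)" if "j < J" for j
  proof -
    let ?q = "n div 2 ^ (j + 1)"
    have "(2::nat) ^ (j + 1) \<le> 2 ^ J" using that by (intro power_increasing) auto
    then have "2 ^ (j + 1) \<le> n" using assms(1) by linarith
    then have "?q \<ge> 1" by (simp add: div_greater_zero_iff Suc_le_eq)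
    have "n < (?q + 1) * 2 ^ (j + 1)"
      using dividend_less_div_times[of "2 ^ (j + 1)" n] by simp
    also have "\<dots> \<le> (2 * ?q) * 2 ^ (j + 1)" using \<open>?q \<ge> 1\<close> by (intro mult_le_mono1) simp
    finally show ?thesis by simp
  qed
  have lower: "(\<Sum>(j, b)\<in>V. card (crossings j b xs)) \<le> OPT_M (grid xs)" if xs: "xs \<in> ?S" for xs
  proof -
    obtain Y where Y: "finite Y" "manhattan_network (grid xs) Y" "card Y = OPT_M (grid xs)"
      using OPT_M_attained[OF finite_dyadic_network permutation_network[OF xs assms(2)]] by blast
    show ?thesis using sum_card_crossings_le[OF \<open>finite V\<close> Y(1,2)] Y(3) by simp
  qed
  have "n * J = (\<Sum>j<J. n)" by simp
  also have "\<dots> \<le> (\<Sum>j<J. 4 * (n div 2 ^ (j + 1) * 2 ^ j))"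
    using level by (intro sum_mono) simp
  also have "\<dots> = 4 * (\<Sum>j<J. \<Sum>b<n div 2 ^ (j + 1). 2 ^ j)" by (simp add: sum_distrib_left)
  also have "\<dots> = 4 * (\<Sum>(j, b)\<in>V. 2 ^ j)" unfolding V_def by (subst sum.Sigma) auto
  finally have "n * J * card ?S \<le> 4 * (\<Sum>(j, b)\<in>V. 2 ^ j) * card ?S" by (rule mult_le_mono1)
  also have "\<dots> = 4 * (\<Sum>(j, b)\<in>V. 2 ^ j * card ?S)"
    by (simp add: sum_distrib_right case_prod_unfold)
  also have "\<dots> \<le> 4 * (\<Sum>(j, b)\<in>V. 2 * (\<Sum>xs\<in>?S. card (crossings j b xs)))"
    using block sum_card_crossings_ge by (intro mult_le_mono2 sum_mono) auto
  also have "\<dots> = 8 * (\<Sum>(j, b)\<in>V. \<Sum>xs\<in>?S. card (crossings j b xs))"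
    by (simp add: sum_distrib_left case_prod_unfold mult.assoc[symmetric])
  also have "(\<Sum>(j, b)\<in>V. \<Sum>xs\<in>?S. card (crossings j b xs)) =
      (\<Sum>xs\<in>?S. \<Sum>(j, b)\<in>V. card (crossings j b xs))"
    unfolding case_prod_unfold by (rule sum.swap)
  also have "8 * \<dots> \<le> 8 * (\<Sum>xs\<in>?S. OPT_M (grid xs))"
    using lower by (intro mult_le_mono2 sum_mono) auto
  finally show ?thesis .
qed

text \<open>The optimum is a function of the relative ordering, so the integral can be taken over
  the uniform law of that ordering, where it is a finite average.\<close>

lemma expectation_OPT_M:
  assumes "uniformly_ordered_points n M X"
  shows "(\<integral>\<omega>. real (OPT_M (X \<omega>)) \<partial>M) =
    (\<Sum>xs\<in>permutations_of_set {1..n}. real (OPT_M (grid xs))) / card (permutations_of_set {1..n})"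
proof -
  let ?S = "permutations_of_set {1..n}"
  let ?h = "\<lambda>xs. real (OPT_M (grid xs))"
  have X: "\<And>\<omega>. \<omega> \<in> space M \<Longrightarrow> finite (X \<omega>) \<and> general_position (X \<omega>)"
    and meas: "(\<lambda>\<omega>. relative_ordering (X \<omega>)) \<in> measurable M (count_space UNIV)"
    and distr: "distr M (count_space UNIV) (\<lambda>\<omega>. relative_ordering (X \<omega>)) =
      measure_pmf (pmf_of_set ?S)"
    using assms unfolding uniformly_ordered_points_def by blast+
  have "(\<integral>\<omega>. real (OPT_M (X \<omega>)) \<partial>M) = (\<integral>\<omega>. ?h (relative_ordering (X \<omega>)) \<partial>M)"
    using X OPT_M_relative_ordering by (intro Bochner_Integration.integral_cong refl) auto
  also have "\<dots> = (\<integral>xs. ?h xs \<partial>distr M (count_space UNIV) (\<lambda>\<omega>. relative_ordering (X \<omega>)))"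
    using meas by (intro integral_distr[symmetric]) auto
  also have "\<dots> = (\<Sum>xs\<in>?S. ?h xs) / card ?S"
    unfolding distr by (rule integral_pmf_of_set) auto
  finally show ?thesis .
qed

theorem theorem14:
  shows "\<exists>c C :: real. \<exists>N :: nat. c > 0 \<and> C > 0 \<and>
    (\<forall>n \<ge> N. \<forall>(M :: 'w measure) (X :: 'w \<Rightarrow> point set).
       uniformly_ordered_points n M X \<longrightarrow>
         c * (real n * ln (real n)) \<le> (\<integral>\<omega>. real (OPT_M (X \<omega>)) \<partial>M) \<and>
         (\<integral>\<omega>. real (OPT_M (X \<omega>)) \<partial>M) \<le> C * (real n * ln (real n)))"
\<comment> \<open>With \<open>J\<close> the binary logarithm of \<open>n\<close> rounded down,
  \<open>1 / 16\<close> comes from the lower bound \<open>n * J / 8\<close> and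
  \<open>ln n \<le> 2 * J\<close>. The constant 8 comes from the upper bound
  \<open>2 * n * (J + 1) \<le> 4 * n * J\<close> and \<open>J \<le> 2 * ln n\<close>. Taking
  \<open>n \<ge> 2\<close> ensures \<open>J \<ge> 1\<close>.\<close>
proof (rule exI[of _ "1 / 16"], rule exI[of _ 8], rule exI[of _ 2], intro conjI allI impI)
  fix n :: nat and M :: "'w measure" and X :: "'w \<Rightarrow> point set"
  assume n: "2 \<le> n" and uniform: "uniformly_ordered_points n M X"
  let ?S = "permutations_of_set {1..n}" and ?E = "\<integral>\<omega>. real (OPT_M (X \<omega>)) \<partial>M"
  obtain J where J: "2 ^ J \<le> n" "n < 2 ^ (J + 1)"
    using ex_power_ivl1[of 2 n] n by auto
  have "J \<noteq> 0" using J(2) n by (intro notI) simp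
  then have J1: "1 \<le> real J" by simp
  have S: "real (card ?S) > 0" by simp
  have E: "?E = (\<Sum>xs\<in>?S. real (OPT_M (grid xs))) / card ?S"
    by (rule expectation_OPT_M[OF uniform])
  have "real (2 ^ J) \<le> real n" "real n \<le> real (2 ^ (J + 1))"
    using J by (simp_all only: of_nat_le_iff less_imp_le)
  then have n_bounds: "2 ^ J \<le> real n" "real n \<le> 2 ^ (J + 1)" by (simp_all del: power_Suc)
  have "ln (2 ^ J :: real) \<le> ln (real n)"
    using n_bounds(1) n by (intro ln_mono) auto
  then have "real J * ln 2 \<le> ln (real n)" by (simp add: ln_realpow)
  moreover have "real J * (1 / 2) \<le> real J * ln 2"
    using ln2_ge_two_thirds by (intro mult_left_mono) auto
  ultimately have J_le: "real J \<le> 2 * ln (real n)" by simp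
  have "ln (real n) \<le> ln (2 ^ (J + 1) :: real)" using n_bounds(2) n by (intro ln_mono) auto
  also have "\<dots> = real (J + 1) * ln 2" by (simp add: ln_realpow del: power_Suc)
  also have "\<dots> \<le> real (J + 1) * 1" using ln_2_less_1 by (intro mult_left_mono) auto
  finally have ln_le: "ln (real n) \<le> 2 * real J" using J1 by simp
  have "real (n * J * card ?S) \<le> real (8 * (\<Sum>xs\<in>?S. OPT_M (grid xs)))"
    using sum_OPT_M_grid_ge[OF J] by (simp only: of_nat_le_iff)
  then have "real n * real J / 8 \<le> ?E" unfolding E using S by (simp add: field_simps)
  moreover have "real n * ln (real n) \<le> real n * (2 * real J)"
    using ln_le by (intro mult_left_mono) auto
  ultimately show "1 / 16 * (real n * ln (real n)) \<le> ?E" by simp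
  have "(\<Sum>xs\<in>?S. real (OPT_M (grid xs))) \<le> (\<Sum>xs\<in>?S. 4 * (real n * real J))"
  proof (rule sum_mono)
    fix xs assume "xs \<in> ?S"
    then have "real (OPT_M (grid xs)) \<le> real (2 * (n * (J + 1)))"
      using OPT_M_grid_le[OF _ J(2)] by (simp only: of_nat_le_iff)
    also have "\<dots> = 2 * (real n * (real J + 1))" by (simp add: algebra_simps)
    also have "\<dots> \<le> 2 * (real n * (2 * real J))" using J1 by (intro mult_left_mono) auto
    finally show "real (OPT_M (grid xs)) \<le> 4 * (real n * real J)" by simp
  qed
  then have "?E \<le> 4 * (real n * real J)" unfolding E using S by (simp add: field_simps)
  also have "\<dots> \<le> 4 * (real n * (2 * ln (real n)))" using J_le by (intro mult_left_mono) auto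
  finally show "?E \<le> 8 * (real n * ln (real n))" by simp
qed auto

end
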